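(* Let $A$ be a non-empty subset of $C(\Omega,\mathbb{C})$ and let $W$ be a vector subspace of $C(\Omega,X)$. Let $W_0$ be a subset of $CV_0W$, and assume that $A$ is a multiplier of $W_0$. Then for every $f\in CV_0W$, $v\in V$ and $p\in\mathcal{A}$ there is an $(A,v)$-antisymmetric set $S$ such that $$d_{v,p,S}(f,W_0)=d_{v,p,\Omega}(f,W_0).$$
   Context: $\Omega$ is a topological space (not assumed Hausdorff). $X$ is a complex locally convex topological vector space (not assumed Hausdorff) whose topology is given by a family $\mathcal{A}$ of seminorms. $C(\Omega,X)$ is the set of continuous maps $\Omega\to X$. For a map $f$ on $\Omega$, $\operatorname{supp} f$ is the closure of $\{x: f(x)\neq 0\}$. $V$ is a Nachbin family, i.e. a set of upper semicontinuous functions $\Omega\to\mathbb{R}_+=[0,\infty)$ (called weights). For $W\subset C(\Omega,X)$, the weighted space $CV_0W$ is the set of $f\in W$ such that for all $v\in V$, $p\in\mathcal{A}$ and $\epsilon>0$ the set $\{x\in\Omega: v(x)p(f(x))\ge\epsilon\}$ is a compact subset of $\Omega$. For $F\subset\Omega$, $f\in CV_0W$ and $B\subset CV_0W$, put $|f|_{v,p,F}=\sup\{v(x)p(f(x)):x\in F\}$ and $d_{v,p,F}(f,B)=\inf\{|f-g|_{v,p,F}:g\in B\}$ (suprema and infima taken in $[0,\infty]$). Multiplier: $\varphi\in C(\Omega,\mathbb{C})$ is a multiplier of a set $W_0\subset C(\Omega,X)$ if $\varphi f+(1-\varphi)g\in W_0$ for all $f,g\in W_0$. A set $A\subset C(\Omega,\mathbb{C})$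 is a multiplier of $W_0$ if every $\varphi\in A$ is. $(A,v)$-antisymmetric set: for $v\in V$, a subset $S\subset\operatorname{supp} v$ such that every $h\in A$ with $h(S)\subset[0,1]$ is constant on $S$. *)

theory Defs
  imports "HOL-Analysis.Analysis" "HOL-Library.Function_Algebras"
begin

text \<open>
  The space \<open>\<Omega>\<close> is an abstract topology \<open>Omega\<close>, possibly with empty carrier. The complex vector
  space \<open>X\<close> is the type \<open>'x\<close> with scalar multiplication \<open>scl\<close>, topologised by a set \<open>P\<close> of
  seminorms. Neither space is assumed to be Hausdorff.
\<close>

definition seminorm :: "(complex \<Rightarrow> 'x \<Rightarrow> 'x) \<Rightarrow> ('x::ab_group_add \<Rightarrow> real) \<Rightarrow> bool" where
  "seminorm scl p \<longleftrightarrow>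
     (\<forall>x. 0 \<le> p x) \<and> (\<forall>x y. p (x + y) \<le> p x + p y) \<and> (\<forall>c x. p (scl c x) = cmod c * p x)"

text \<open>
  The whole space is added to the subbase of open balls because the carrier of a generated topology
  is the union of its subbase, which would be empty for \<open>P = {}\<close>.
\<close>

definition seminorm_topology :: "('x::ab_group_add \<Rightarrow> real) set \<Rightarrow> 'x topology" where
  "seminorm_topology P =
     topology_generated_by (insert UNIV {{y. p (y - a) < r} | p a r. p \<in> P \<and> 0 < r})"

text \<open>
  A map on the carrier of \<open>Omega\<close> is represented by its extension by zero to the whole type, so that
  equality of representatives is equality on the carrier and the pointwise operations
  are those of the function type.
\<close>

definition cont_maps :: "'w topology \<Rightarrow> 'z topology \<Rightarrow> ('w \<Rightarrow> 'z::zero) set" where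
  "cont_maps Omega T = {f. continuous_map Omega T f \<and> (\<forall>x. x \<notin> topspace Omega \<longrightarrow> f x = 0)}"

definition supp :: "'w topology \<Rightarrow> ('w \<Rightarrow> 'z::zero) \<Rightarrow> 'w set" where
  "supp Omega f = Omega closure_of {x \<in> topspace Omega. f x \<noteq> 0}"

definition upper_semicontinuous_map :: "'w topology \<Rightarrow> ('w \<Rightarrow> real) \<Rightarrow> bool" where
  "upper_semicontinuous_map Omega v \<longleftrightarrow> (\<forall>a. openin Omega {x \<in> topspace Omega. v x < a})"

definition nachbin_family :: "'w topology \<Rightarrow> ('w \<Rightarrow> real) set \<Rightarrow> bool" where
  "nachbin_family Omega V \<longleftrightarrow>
     (\<forall>v\<in>V. upper_semicontinuous_map Omega v \<and> (\<forall>x\<in>topspace Omega. 0 \<le> v x))"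

definition CV0 ::
  "'w topology \<Rightarrow> ('x \<Rightarrow> real) set \<Rightarrow> ('w \<Rightarrow> real) set \<Rightarrow> ('w \<Rightarrow> 'x) set \<Rightarrow> ('w \<Rightarrow> 'x) set" where
  "CV0 Omega P V W =
     {f \<in> W. \<forall>v\<in>V. \<forall>p\<in>P. \<forall>\<epsilon>>0. compactin Omega {x \<in> topspace Omega. v x * p (f x) \<ge> \<epsilon>}}"

text \<open>
  In \<^typ>\<open>ennreal\<close> the supremum of the empty set is \<open>0\<close> and the infimum of the empty set is \<open>\<infinity>\<close>, as
  for suprema and infima taken in \<open>[0,\<infinity>]\<close>.
\<close>

definition wnorm :: "('w \<Rightarrow> real) \<Rightarrow> ('x \<Rightarrow> real) \<Rightarrow> 'w set \<Rightarrow> ('w \<Rightarrow> 'x) \<Rightarrow> ennreal" where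
  "wnorm v p F f = (SUP x\<in>F. ennreal (v x * p (f x)))"

definition wdist ::
  "('w \<Rightarrow> real) \<Rightarrow> ('x::ab_group_add \<Rightarrow> real) \<Rightarrow> 'w set \<Rightarrow> ('w \<Rightarrow> 'x) \<Rightarrow> ('w \<Rightarrow> 'x) set \<Rightarrow> ennreal" where
  "wdist v p F f B = (INF g\<in>B. wnorm v p F (f - g))"

definition multiplier ::
  "'w topology \<Rightarrow> (complex \<Rightarrow> 'x \<Rightarrow> 'x) \<Rightarrow> ('w \<Rightarrow> complex) \<Rightarrow> ('w \<Rightarrow> 'x::ab_group_add) set \<Rightarrow> bool" where
  "multiplier Omega scl \<phi> W0 \<longleftrightarrow>
     \<phi> \<in> cont_maps Omega euclidean \<and>
     (\<forall>f\<in>W0. \<forall>g\<in>W0. (\<lambda>x. scl (\<phi> x) (f x) + scl (1 - \<phi> x) (g x)) \<in> W0)"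

text \<open>The empty set is antisymmetric; it is the only choice when \<open>v\<close> vanishes identically.\<close>

definition antisymmetric ::
  "'w topology \<Rightarrow> ('w \<Rightarrow> complex) set \<Rightarrow> ('w \<Rightarrow> real) \<Rightarrow> 'w set \<Rightarrow> bool" where
  "antisymmetric Omega A v S \<longleftrightarrow>
     S \<subseteq> supp Omega v \<and> (\<forall>h\<in>A. h ` S \<subseteq> complex_of_real ` {0..1} \<longrightarrow> h constant_on S)"

end

theory Submission
  imports Defs
begin

text \<open>
  By compactness and Zorn's lemma there is a minimal closed \<open>F \<subseteq> supp v\<close> on which the distance is
  still attained. If some \<open>h \<in> A\<close> with values in \<open>[0,1]\<close> were not constant on \<open>F\<close>, then for suitable
  \<open>a < b\<close> the closed sets \<open>{h \<le> b}\<close> and \<open>{h \<ge> a}\<close> would be proper subsets of \<open>F\<close>, so \<open>f\<close> would have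
  strictly better approximants on each of them. Multipliers are stable under products and under
  \<open>\<phi> \<mapsto> 1 - \<phi>\<close>, hence \<open>(1 - h^n)^N\<close> is one; for suitable \<open>n\<close>, \<open>N\<close> it is
  close to \<open>1\<close> where \<open>h \<le> a\<close> and close to \<open>0\<close> where \<open>h \<ge> b\<close>, and it glues the two approximants to
  one that is strictly better on all of \<open>F\<close>, a contradiction.
\<close>

section \<open>Minimal closed sets by compactness and Zorn's lemma\<close>

text \<open>A finite nonempty subfamily of a chain has its intersection as a member, so
  \<open>ne\<close> already yields the finite intersection property relative to
  \<open>K\<close>.\<close>

lemma compactin_Int_Inter_chain:
  assumes K: "compactin X K" and C: "subset.chain \<A> C" "C \<noteq> {}"
    and closed: "\<And>F. F \<in> C \<Longrightarrow> closedin X F" and ne: "\<And>F. F \<in> C \<Longrightarrow> K \<inter> F \<noteq> {}"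
  shows "K \<inter> \<Inter>C \<noteq> {}"
proof -
  have fip: "K \<inter> \<Inter>\<F> \<noteq> {}" if "finite \<F>" "\<F> \<subseteq> C" for \<F>
  proof (cases "\<F> = {}")
    case True
    obtain F where "F \<in> C"
      using C(2) by blast
    then have "K \<noteq> {}"
      using ne[of F] by blast
    then show ?thesis
      using True by simp
  next
    case False
    have "\<F> \<subseteq> \<A>"
      using C(1) that(2) unfolding subset_chain_def by (meson subset_trans)
    moreover have "\<forall>X\<in>\<F>. \<forall>Y\<in>\<F>. X \<subseteq> Y \<or> Y \<subseteq> X"
      using C(1) that(2) unfolding subset_chain_def by (meson subsetD)
    ultimately have "subset.chain \<A> \<F>"
      unfolding subset_chain_def by (rule conjI)
    then have "\<Inter>\<F> \<in> \<F>"
      by (rule Inter_in_chain[OF that(1) False])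
    with that(2) have "\<Inter>\<F> \<in> C"
      by (rule subsetD)
    then show ?thesis
      by (rule ne)
  qed
  have "(\<forall>F\<in>C. closedin X F) \<and> (\<forall>\<F>. finite \<F> \<and> \<F> \<subseteq> C \<longrightarrow> K \<inter> \<Inter>\<F> \<noteq> {})"
    by (intro conjI ballI allI impI closed fip) simp_all
  then show ?thesis
    by (rule mp[OF spec[OF conjunct2[OF iffD1[OF compactin_fip K]]]])
qed

text \<open>Zorn's lemma for reverse inclusion. A nonempty chain is bounded by its intersection: a
  superlevel set of \<open>q\<close> at a positive level below \<open>d\<close> is compact and meets
  every member, hence meets the intersection. In the application \<open>Q\<close> consists of the
  weighted errors of all approximants and \<open>d\<close> is the distance.\<close>

lemma exists_minimal_closed_set:
  fixes X :: "'w topology" and Q :: "('w \<Rightarrow> real) set" and d :: ennreal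
  assumes cpt: "\<And>q \<epsilon>. q \<in> Q \<Longrightarrow> 0 < \<epsilon> \<Longrightarrow> compactin X {x \<in> topspace X. \<epsilon> \<le> q x}"
    and F0: "closedin X F0" "\<And>q. q \<in> Q \<Longrightarrow> d \<le> (SUP x\<in>F0. ennreal (q x))"
  shows "\<exists>F. closedin X F \<and> F \<subseteq> F0 \<and> (\<forall>q\<in>Q. d \<le> (SUP x\<in>F. ennreal (q x))) \<and>
    (\<forall>F'. closedin X F' \<longrightarrow> F' \<subset> F \<longrightarrow> (\<exists>q\<in>Q. (SUP x\<in>F'. ennreal (q x)) < d))"
proof -
  define \<A> where "\<A> = {F. closedin X F \<and> F \<subseteq> F0 \<and> (\<forall>q\<in>Q. d \<le> (SUP x\<in>F. ennreal (q x)))}"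
  have "\<exists>m\<in>\<A>. \<forall>a\<in>\<A>. a \<subseteq> m \<longrightarrow> a = m"
  proof (rule predicate_Zorn[where P = "\<lambda>x y. y \<subseteq> x"])
    show "partial_order_on \<A> (relation_of (\<lambda>x y. y \<subseteq> x) \<A>)"
      by (rule partial_order_on_relation_ofI) auto
  next
    fix C assume C: "C \<in> Chains (relation_of (\<lambda>x y. y \<subseteq> x) \<A>)"
    then have CA: "C \<subseteq> \<A>"
      by (rule Chains_relation_of)
    have chain: "subset.chain \<A> C"
      using C CA unfolding subset_chain_def Chains_def relation_of_def by blast
    show "\<exists>u\<in>\<A>. \<forall>a\<in>C. u \<subseteq> a"
    proof (cases "C = {}")
      case True
      then show ?thesis
        using F0 unfolding \<A>_def by blast
    next
      case C: False
      have "d \<le> (SUP x\<in>\<Inter>C. ennreal (q x))" if q: "q \<in> Q" for q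
      proof (rule dense_le)
        fix c :: ennreal assume "c < d"
        \<comment> \<open>Since \<open>e < d\<close>, each member of the chain contains a point
          where \<open>q\<close> exceeds \<open>e\<close>; since \<open>c < e\<close>, the level
          \<open>e\<close> is positive, as \<open>cpt\<close> demands.\<close>
        then obtain e where e: "c < e" "e < d"
          using dense by blast
        define r where "r = enn2real e"
        have er: "e = ennreal r"
          using e(2) unfolding r_def by (metis ennreal_enn2real order_less_le_trans top_greatest)
        have r: "0 < r"
          using e(1) unfolding er by (metis ennreal_neg not_le not_less_zero order_less_imp_le)
        let ?K = "{x \<in> topspace X. r \<le> q x}"
        have ne: "?K \<inter> F \<noteq> {}" if "F \<in> \<A>" for F
        proof -
          have "e < (SUP x\<in>F. ennreal (q x))"
            using that e(2) q unfolding \<A>_def by (blast intro: less_le_trans)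
          then obtain x where x: "x \<in> F" "e < ennreal (q x)"
            unfolding less_SUP_iff by blast
          then have "r \<le> q x"
            using r by (simp add: er ennreal_less_iff)
          moreover have "x \<in> topspace X"
            using x that closedin_subset unfolding \<A>_def by blast
          ultimately show ?thesis
            using x by blast
        qed
        have "?K \<inter> \<Inter>C \<noteq> {}"
          using CA ne by (intro compactin_Int_Inter_chain[OF cpt[OF q r] chain C]) (auto simp: \<A>_def)
        then obtain x where "x \<in> ?K \<inter> \<Inter>C"
          unfolding ex_in_conv[symmetric] by (elim exE)
        then have x: "x \<in> \<Inter>C" "r \<le> q x"
          by simp_all
        have "c \<le> ennreal (q x)"
          using e x r by (metis er ennreal_leI less_imp_le order_trans)
        also have "\<dots> \<le> (SUP x\<in>\<Inter>C. ennreal (q x))"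
          using x by (intro SUP_upper)
        finally show "c \<le> (SUP x\<in>\<Inter>C. ennreal (q x))" .
      qed
      moreover have "closedin X (\<Inter>C)" "\<Inter>C \<subseteq> F0"
        using C CA unfolding \<A>_def by (blast intro: closedin_Inter)+
      ultimately show ?thesis
        unfolding \<A>_def by blast
    qed
  qed
  then obtain F where F: "F \<in> \<A>" and min: "\<And>F'. F' \<in> \<A> \<Longrightarrow> F' \<subseteq> F \<Longrightarrow> F' = F"
    by blast
  have "\<exists>q\<in>Q. (SUP x\<in>F'. ennreal (q x)) < d" if "closedin X F'" "F' \<subset> F" for F'
  proof -
    have "F' \<notin> \<A>" "F' \<subseteq> F0"
      using that min[of F'] F unfolding \<A>_def by auto
    then show ?thesis
      using that unfolding \<A>_def by (simp add: not_le)
  qed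
  then show ?thesis
    using F unfolding \<A>_def by blast
qed

section \<open>Polynomials approximating a step function\<close>

text \<open>
  The exponent \<open>N\<close> is chosen between \<open>b\<^sup>-\<^sup>n\<close> and \<open>a\<^sup>-\<^sup>n\<close>, namely near \<open>c^n\<close> with \<open>c = 1 / sqrt (a b)\<close>.
\<close>

lemma approximate_step_polynomial:
  fixes a b e :: real
  assumes "0 < a" "a < b" "b < 1" "0 < e"
  obtains n N :: nat
  where "\<And>t. 0 \<le> t \<Longrightarrow> t \<le> a \<Longrightarrow> 1 - (1 - t ^ n) ^ N \<le> e"
    "\<And>t. b \<le> t \<Longrightarrow> t \<le> 1 \<Longrightarrow> (1 - t ^ n) ^ N \<le> e"
proof -
  define c where "c = 1 / sqrt (a * b)"
  have ab: "a * a < a * b" "a * b < b * b"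
    using assms by auto
  \<comment> \<open>The geometric mean of \<open>a\<close> and \<open>b\<close> lies strictly
    between them; hence \<open>(a * c) ^ n\<close> tends to 0 and \<open>(b * c) ^ n\<close> is
    unbounded.\<close>
  have c: "0 < c" "a * c < 1" "1 < b * c"
  proof -
    show "0 < c"
      using assms by (simp add: c_def)
    have "a < sqrt (a * b)"
      using ab assms by (intro real_less_rsqrt) (simp add: power2_eq_square)
    then show "a * c < 1"
      using assms by (simp add: c_def)
    have "sqrt (a * b) < b"
      using ab assms by (intro real_less_lsqrt) (simp_all add: power2_eq_square)
    then show "1 < b * c"
      using assms by (simp add: c_def)
  qed
  \<comment> \<open>The summand \<open>a ^ n\<close> pays for rounding \<open>c ^ n\<close> up to
    the integer \<open>N\<close>.\<close>
  have "(\<lambda>n. (a * c) ^ n + a ^ n) \<longlonglongrightarrow> 0 + 0"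
    using assms c by (intro tendsto_add LIMSEQ_realpow_zero) auto
  then have ev1: "\<forall>\<^sub>F n in sequentially. (a * c) ^ n + a ^ n < e"
    using assms by (auto dest: order_tendstoD)
  obtain n0 where n0: "1 / e < (b * c) ^ n0"
    using real_arch_pow c by blast
  obtain n where n: "(a * c) ^ n + a ^ n < e" "n0 \<le> n"
    using eventually_conj[OF ev1 eventually_ge_at_top[of n0]] eventually_happens'
      sequentially_bot by blast
  have n': "1 / e < (b * c) ^ n"
    using n0 n c by (meson less_imp_le less_le_trans power_increasing)
  define N where "N = nat \<lceil>c ^ n\<rceil>"
  have N: "c ^ n \<le> real N" "real N \<le> c ^ n + 1"
    using c by (auto simp: N_def real_nat_ceiling_ge)
  show thesis
  proof (rule that[of n N])
    fix t :: real assume t: "0 \<le> t" "t \<le> a"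
    have tn: "t ^ n \<le> a ^ n" "t ^ n \<le> 1"
      using t assms by (auto intro: power_mono power_le_one)
    have "1 - real N * t ^ n \<le> (1 - t ^ n) ^ N"
      using Bernoulli_inequality[of "- (t ^ n)" N] tn by simp
    moreover have "real N * t ^ n \<le> (c ^ n + 1) * a ^ n"
      using N tn t c by (intro mult_mono) auto
    moreover have "(c ^ n + 1) * a ^ n = (a * c) ^ n + a ^ n"
      by (simp add: algebra_simps power_mult_distrib)
    ultimately show "1 - (1 - t ^ n) ^ N \<le> e"
      using n by linarith
  next
    fix t :: real assume t: "b \<le> t" "t \<le> 1"
    have tn: "b ^ n \<le> t ^ n" "t ^ n \<le> 1"
      using t assms by (auto intro: power_mono power_le_one)
    \<comment> \<open>From \<open>1 - y \<le> exp (- y)\<close> the power is at most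
      \<open>exp (- (N * t ^ n))\<close>, which is below \<open>e\<close> as soon as
      \<open>N * t ^ n\<close> exceeds \<open>1 / e\<close>.\<close>
    have "1 / e < (b * c) ^ n"
      by (fact n')
    also have "\<dots> = c ^ n * b ^ n"
      by (simp add: power_mult_distrib)
    also have "\<dots> \<le> real N * t ^ n"
      using N tn c assms by (intro mult_mono) auto
    also have "\<dots> < exp (real N * t ^ n)"
      using exp_ge_add_one_self[of "real N * t ^ n"] by linarith
    finally have "exp (- (real N * t ^ n)) < e"
      using assms by (simp add: exp_minus field_simps)
    moreover have "(1 - t ^ n) ^ N \<le> exp (- (t ^ n)) ^ N"
      using tn exp_ge_add_one_self[of "- (t ^ n)"] by (intro power_mono) auto
    moreover have "exp (- (t ^ n)) ^ N = exp (- (real N * t ^ n))"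
      by (simp add: exp_of_nat_mult[symmetric])
    ultimately show "(1 - t ^ n) ^ N \<le> e"
      by linarith
  qed
qed

section \<open>Closure properties of multipliers\<close>

text \<open>
  Unlike \<^const>\<open>multiplier\<close>, this does not ask \<open>\<phi>\<close> to vanish off the carrier, a condition
  that \<open>1 - \<phi>\<close> violates.
\<close>

definition blends ::
  "(complex \<Rightarrow> 'x \<Rightarrow> 'x) \<Rightarrow> ('w \<Rightarrow> 'x::ab_group_add) set \<Rightarrow> ('w \<Rightarrow> complex) \<Rightarrow> bool" where
  "blends scl W0 \<phi> \<longleftrightarrow>
     (\<forall>f\<in>W0. \<forall>g\<in>W0. (\<lambda>x. scl (\<phi> x) (f x) + scl (1 - \<phi> x) (g x)) \<in> W0)"

lemma blends_complement: "blends scl W0 \<phi> \<Longrightarrow> blends scl W0 (\<lambda>x. 1 - \<phi> x)"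
  unfolding blends_def by (simp add: add.commute)

text \<open>Blend \<open>f\<close> and \<open>g\<close> by \<open>\<psi>\<close>, then blend the
  result with the same \<open>g\<close> by \<open>\<phi>\<close>: the coefficient of
  \<open>f\<close> becomes the product, and the coefficients still sum to 1.\<close>

lemma blends_mult:
  assumes "vector_space scl" "blends scl W0 \<phi>" "blends scl W0 \<psi>"
  shows "blends scl W0 (\<lambda>x. \<phi> x * \<psi> x)"
  unfolding blends_def
proof (intro ballI)
  interpret vector_space scl by fact
  fix f g assume fg: "f \<in> W0" "g \<in> W0"
  have "(\<lambda>x. scl (\<phi> x) (scl (\<psi> x) (f x) + scl (1 - \<psi> x) (g x)) + scl (1 - \<phi> x) (g x)) \<in> W0"
    using assms(2)[unfolded blends_def, rule_format, OF _ fg(2),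
        OF assms(3)[unfolded blends_def, rule_format, OF fg]] .
  moreover have "scl (\<phi> x) (scl (\<psi> x) (f x) + scl (1 - \<psi> x) (g x)) + scl (1 - \<phi> x) (g x)
      = scl (\<phi> x * \<psi> x) (f x) + scl (1 - \<phi> x * \<psi> x) (g x)" for x
  proof -
    have "1 - \<phi> x * \<psi> x = \<phi> x * (1 - \<psi> x) + (1 - \<phi> x)"
      by (simp add: algebra_simps)
    then have "scl (1 - \<phi> x * \<psi> x) (g x) = scl (\<phi> x) (scl (1 - \<psi> x) (g x)) + scl (1 - \<phi> x) (g x)"
      by (simp only: scale_left_distrib scale_scale)
    then show ?thesis
      by (simp only: scale_right_distrib scale_scale add.assoc)
  qed
  ultimately show "(\<lambda>x. scl (\<phi> x * \<psi> x) (f x) + scl (1 - \<phi> x * \<psi> x) (g x)) \<in> W0"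
    by simp
qed

lemma blends_power:
  assumes "vector_space scl" "blends scl W0 \<phi>"
  shows "blends scl W0 (\<lambda>x. \<phi> x ^ n)"
proof (induction n)
  case 0
  interpret vector_space scl by fact
  show ?case
    by (simp add: blends_def)
next
  case (Suc n)
  then show ?case
    using blends_mult[OF assms(1) assms(2)] by simp
qed

section \<open>Semicontinuity, differences and boundedness in the weighted space\<close>

text \<open>Both factors are nonnegative and upper semicontinuous, so local upper bounds
  \<open>s\<close> and \<open>t\<close> with \<open>s * t < c\<close> can be multiplied.\<close>

lemma openin_seminorm_less:
  assumes scl: "vector_space scl" and p: "p \<in> P" "seminorm scl p"
    and v: "upper_semicontinuous_map Omega v" "\<And>x. x \<in> topspace Omega \<Longrightarrow> 0 \<le> v x"
    and u: "continuous_map Omega (seminorm_topology P) u"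
  shows "openin Omega {x \<in> topspace Omega. v x * p (u x) < c}"
proof (subst openin_subopen, intro ballI)
  fix x0 assume x0: "x0 \<in> {x \<in> topspace Omega. v x * p (u x) < c}"
  have p0: "0 \<le> p y" and ptri: "p (y + z) \<le> p y + p z" for y z
    using p unfolding seminorm_def by auto
  interpret vector_space scl by fact
  have pz: "p 0 = 0"
    using p(2) scale_zero_left unfolding seminorm_def by (metis mult_zero_left norm_zero)
  have "\<exists>s t. v x0 < s \<and> p (u x0) < t \<and> s * t < c"
  proof -
    \<comment> \<open>Raising both factors by the same small \<open>e\<close> keeps the product
      below \<open>c\<close> by continuity.\<close>
    have "((\<lambda>e. (v x0 + e) * (p (u x0) + e)) \<longlongrightarrow> (v x0 + 0) * (p (u x0) + 0)) (at_right 0)"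
      by (intro tendsto_intros)
    then have "\<forall>\<^sub>F e in at_right 0. (v x0 + e) * (p (u x0) + e) < c"
      using x0 by (intro order_tendstoD(2)) auto
    then have "\<forall>\<^sub>F e in at_right 0. (v x0 + e) * (p (u x0) + e) < c \<and> 0 < e"
      by (intro eventually_conj eventually_at_right_less)
    then obtain e where "(v x0 + e) * (p (u x0) + e) < c" "0 < e"
      by (metis (mono_tags, lifting) eventually_happens' trivial_limit_at_right_real)
    then show ?thesis
      by (intro exI[of _ "v x0 + e"] exI[of _ "p (u x0) + e"]) auto
  qed
  then obtain s t where st: "v x0 < s" "p (u x0) < t" "s * t < c"
    by blast
  \<comment> \<open>The radius is chosen so that the triangle inequality gives
    \<open>p (u x) \<le> t\<close> on the preimage of the ball.\<close>
  let ?B = "{y. p (y - u x0) < t - p (u x0)}"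
  let ?T = "{x \<in> topspace Omega. v x < s} \<inter> {x \<in> topspace Omega. u x \<in> ?B}"
  have "openin (seminorm_topology P) ?B"
    unfolding seminorm_topology_def
  proof (rule topology_generated_by_Basis)
    have "0 < t - p (u x0)"
      using st by simp
    then show "?B \<in> insert UNIV {{y. p (y - a) < r} |p a r. p \<in> P \<and> 0 < r}"
      using p(1) by blast
  qed
  then have "openin Omega ?T"
    using u v unfolding upper_semicontinuous_map_def
    by (intro openin_Int openin_continuous_map_preimage) auto
  moreover have "x0 \<in> ?T"
    using x0 st pz by auto
  moreover have "?T \<subseteq> {x \<in> topspace Omega. v x * p (u x) < c}"
  proof clarsimp
    fix x assume x: "x \<in> topspace Omega" "v x < s" "p (u x - u x0) < t - p (u x0)"
    have "p (u x) \<le> t"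
      using ptri[of "u x - u x0" "u x0"] x by simp
    then have "v x * p (u x) \<le> s * t"
      using x v(2)[of x] p0 by (intro mult_mono) (auto simp: order_trans[OF p0])
    then show "v x * p (u x) < c"
      using st by linarith
  qed
  ultimately show "\<exists>T. openin Omega T \<and> x0 \<in> T \<and> T \<subseteq> {x \<in> topspace Omega. v x * p (u x) < c}"
    by blast
qed

text \<open>If the weighted seminorm of \<open>f - g\<close> is at least \<open>e\<close>, that of
  \<open>f\<close> or of \<open>g\<close> is at least \<open>e/2\<close>. The superlevel set is thus
  contained in a union of two compact sets, and it is closed by upper semicontinuity.\<close>

lemma CV0_diff:
  assumes scl: "vector_space scl" and P: "\<forall>p\<in>P. seminorm scl p"
    and V: "nachbin_family Omega V"
    and W: "W \<subseteq> cont_maps Omega (seminorm_topology P)"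
      "module.subspace (\<lambda>c f x. scl c (f x)) W"
    and fg: "f \<in> CV0 Omega P V W" "g \<in> CV0 Omega P V W"
  shows "f - g \<in> CV0 Omega P V W"
proof -
  interpret vector_space scl by fact
  interpret F: module "\<lambda>c (f :: 'b \<Rightarrow> 'a) x. scl c (f x)"
    by unfold_locales (auto simp: fun_eq_iff scale_left_distrib scale_right_distrib)
  have minus: "p (- y) = p y" if "p \<in> P" for p y
    using P that unfolding seminorm_def
    by (metis norm_minus_cancel norm_one mult_1 scale_minus_left scale_one)
  have WW: "f \<in> W" "g \<in> W" "f - g \<in> W"
    using fg W F.subspace_diff unfolding CV0_def by auto
  show ?thesis
    unfolding CV0_def
  proof (intro CollectI conjI ballI allI impI)
    fix v p and e :: real assume vp: "v \<in> V" "p \<in> P" "0 < e"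
    have v: "upper_semicontinuous_map Omega v" "\<And>x. x \<in> topspace Omega \<Longrightarrow> 0 \<le> v x"
      using V vp unfolding nachbin_family_def by auto
    let ?K = "\<lambda>u e. {x \<in> topspace Omega. e \<le> v x * p (u x)}"
    have "continuous_map Omega (seminorm_topology P) (f - g)"
      using WW(3) W(1) unfolding cont_maps_def by blast
    then have "openin Omega {x \<in> topspace Omega. v x * p ((f - g) x) < e}"
      by (intro openin_seminorm_less[of scl p P] scl vp v bspec[OF P])
    moreover have "?K (f - g) e = topspace Omega - {x \<in> topspace Omega. v x * p ((f - g) x) < e}"
      by auto
    ultimately have "closedin Omega (?K (f - g) e)"
      by (simp only: openin_closedin_eq)
    moreover have "compactin Omega (?K f (e/2) \<union> ?K g (e/2))"
      using fg vp half_gt_zero[OF vp(3)] unfolding CV0_def by (intro compactin_Un) blast+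
    moreover have "?K (f - g) e \<subseteq> ?K f (e/2) \<union> ?K g (e/2)"
    proof
      fix x assume x: "x \<in> ?K (f - g) e"
      have "p (f x - g x) \<le> p (f x) + p (g x)"
        using P vp minus unfolding seminorm_def by (metis diff_conv_add_uminus)
      then have "v x * p (f x - g x) \<le> v x * p (f x) + v x * p (g x)"
        using v x by (metis (no_types, lifting) distrib_left mem_Collect_eq mult_left_mono)
      then show "x \<in> ?K f (e/2) \<union> ?K g (e/2)"
        using x by auto
    qed
    ultimately show "compactin Omega (?K (f - g) e)"
      using closed_compactin by blast
  qed (fact WW)
qed

text \<open>The open sets \<open>U n\<close> cover the compact set where the weighted seminorm is at
  least 1, so finitely many suffice; elsewhere 1 is a bound.\<close>

lemma CV0_bounded:
  assumes scl: "vector_space scl" and P: "\<forall>p\<in>P. seminorm scl p" and V: "nachbin_family Omega V"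
    and W: "W \<subseteq> cont_maps Omega (seminorm_topology P)"
    and u: "u \<in> CV0 Omega P V W" and vp: "v \<in> V" "p \<in> P"
  obtains M where "0 \<le> M" "\<And>x. x \<in> topspace Omega \<Longrightarrow> v x * p (u x) \<le> M"
proof -
  let ?K = "{x \<in> topspace Omega. 1 \<le> v x * p (u x)}"
  define U where "U n = {x \<in> topspace Omega. v x * p (u x) < real n}" for n :: nat
  have "compactin Omega ?K"
    using u vp unfolding CV0_def by auto
  moreover have "openin Omega T" if "T \<in> range U" for T
    using that scl u W P vp V unfolding U_def CV0_def nachbin_family_def cont_maps_def
    by (auto intro!: openin_seminorm_less[of scl p P])
  moreover have "?K \<subseteq> \<Union>(range U)"
  proof
    fix x assume "x \<in> ?K"
    moreover obtain n where "v x * p (u x) < real n"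
      using reals_Archimedean2 by blast
    ultimately have "x \<in> U n"
      by (simp add: U_def)
    then show "x \<in> \<Union>(range U)"
      by blast
  qed
  ultimately obtain \<F> where \<F>: "finite \<F>" "\<F> \<subseteq> range U" "?K \<subseteq> \<Union>\<F>"
    using compactinD[of Omega ?K "range U"] by auto
  then obtain I where I: "finite I" "\<F> = U ` I"
    by (meson finite_subset_image)
  show thesis
  \<comment> \<open>Inserting 1 covers the points outside \<open>?K\<close> and keeps
    \<open>Max\<close> meaningful when \<open>I\<close> is empty.\<close>
  proof (rule that[of "real (Max (insert 1 I))"])
    fix x assume x: "x \<in> topspace Omega"
    show "v x * p (u x) \<le> real (Max (insert 1 I))"
    proof (cases "x \<in> ?K")
      case True
      then obtain n where "n \<in> I" "v x * p (u x) < real n"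
        using \<F> I U_def by auto
      moreover from this have "real n \<le> real (Max (insert 1 I))"
        using I by simp
      ultimately show ?thesis
        by linarith
    next
      case False
      have "real 1 \<le> real (Max (insert 1 I))"
        using I by (intro of_nat_mono Max_ge) auto
      then show ?thesis
        using False x by auto
    qed
  qed simp
qed

section \<open>A minimal set attaining the distance is antisymmetric\<close>

theorem theorem2p8:
  fixes Omega :: "'w topology"
    and scl :: "complex \<Rightarrow> 'x::ab_group_add \<Rightarrow> 'x"
    and P :: "('x \<Rightarrow> real) set"
    and V :: "('w \<Rightarrow> real) set"
    and A :: "('w \<Rightarrow> complex) set"
    and W W0 :: "('w \<Rightarrow> 'x) set"
  assumes "vector_space scl"
    and "\<forall>p\<in>P. seminorm scl p"
    and "nachbin_family Omega V"
    and "A \<noteq> {}" and "A \<subseteq> cont_maps Omega euclidean"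
    and "W \<subseteq> cont_maps Omega (seminorm_topology P)"
    and "module.subspace (\<lambda>c f x. scl c (f x)) W"
    and "W0 \<subseteq> CV0 Omega P V W"
    and "\<forall>\<phi>\<in>A. multiplier Omega scl \<phi> W0"
  shows "\<forall>f \<in> CV0 Omega P V W. \<forall>v\<in>V. \<forall>p\<in>P.
           \<exists>S. antisymmetric Omega A v S \<and>
               wdist v p S f W0 = wdist v p (topspace Omega) f W0"
proof (intro ballI)
  fix f v p assume f: "f \<in> CV0 Omega P V W" and v: "v \<in> V" and p: "p \<in> P"
  interpret vector_space scl by fact
  have sp: "0 \<le> p x" "p (x + y) \<le> p x + p y" "p (scl c x) = cmod c * p x" for x y c
    using assms(2) p unfolding seminorm_def by auto
  have v0: "0 \<le> v x" if "x \<in> topspace Omega" for x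
    using assms(3) v that unfolding nachbin_family_def by auto
  define d where "d = wdist v p (topspace Omega) f W0"
  define q where "q g x = v x * p (f x - g x)" for g x
  have wd: "wdist v p F f W0 = (INF g\<in>W0. SUP x\<in>F. ennreal (q g x))" for F
    by (simp add: wdist_def wnorm_def q_def)
  have wd_mono: "wdist v p F f W0 \<le> d" if "F \<subseteq> topspace Omega" for F
    unfolding d_def wd using that by (intro INF_mono') (auto intro: SUP_subset_mono)
  have diff: "f - g \<in> CV0 Omega P V W" if "g \<in> W0" for g
    using CV0_diff[OF assms(1-3,6,7) f] assms(8) that by blast
  have sub: "supp Omega v \<subseteq> topspace Omega"
    unfolding supp_def by (rule closure_of_subset_topspace)
  show "\<exists>S. antisymmetric Omega A v S \<and> wdist v p S f W0 = wdist v p (topspace Omega) f W0"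
  proof (cases "d = 0")
    case True
    \<comment> \<open>The supremum over the empty set is 0, so the empty set attains the distance
      0.\<close>
    then have "wdist v p {} f W0 = wdist v p (topspace Omega) f W0"
      using wd_mono[of "{}"] by (simp add: d_def)
    then show ?thesis
      by (intro exI[of _ "{}"]) (simp add: antisymmetric_def constant_on_def)
  next
    case False
    have cpt: "compactin Omega {x \<in> topspace Omega. \<epsilon> \<le> u x}" if "u \<in> q ` W0" "0 < \<epsilon>" for u \<epsilon>
      using that diff v p unfolding CV0_def q_def by fastforce
    have closed_supp: "closedin Omega (supp Omega v)"
      by (simp add: supp_def)
    \<comment> \<open>The weighted error is 0 wherever \<open>v\<close> vanishes, so Zorn's lemma
      may start from the support.\<close>
    have d_supp: "d \<le> (SUP x\<in>supp Omega v. ennreal (u x))" if u: "u \<in> q ` W0" for u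
    proof -
      obtain g where g: "g \<in> W0" "u = q g"
        using u by blast
      have "d \<le> (SUP x\<in>topspace Omega. ennreal (u x))"
        unfolding d_def wd using g by (auto intro: INF_lower)
      also have "\<dots> \<le> (SUP x\<in>supp Omega v. ennreal (u x))"
      proof (rule SUP_least)
        fix x assume x: "x \<in> topspace Omega"
        show "ennreal (u x) \<le> (SUP x\<in>supp Omega v. ennreal (u x))"
        proof (cases "v x = 0")
          case True
          then show ?thesis
            by (simp add: g q_def)
        next
          case False
          then have "x \<in> supp Omega v"
            using x closure_of_subset[of "{x \<in> topspace Omega. v x \<noteq> 0}" Omega]
            unfolding supp_def by auto
          then show ?thesis
            by (rule SUP_upper)
        qed
      qed
      finally show ?thesis .
    qed
    have "\<exists>F. closedin Omega F \<and> F \<subseteq> supp Omega v \<and>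
        (\<forall>u\<in>q ` W0. d \<le> (SUP x\<in>F. ennreal (u x))) \<and>
        (\<forall>F'. closedin Omega F' \<longrightarrow> F' \<subset> F \<longrightarrow>
          (\<exists>u\<in>q ` W0. (SUP x\<in>F'. ennreal (u x)) < d))"
      by (intro exists_minimal_closed_set cpt closed_supp d_supp)
    then obtain F where F: "closedin Omega F" "F \<subseteq> supp Omega v"
      and dF: "\<forall>u\<in>q ` W0. d \<le> (SUP x\<in>F. ennreal (u x))"
      and min: "\<forall>F'. closedin Omega F' \<longrightarrow> F' \<subset> F \<longrightarrow>
        (\<exists>u\<in>q ` W0. (SUP x\<in>F'. ennreal (u x)) < d)"
      by (elim exE conjE)
    have FO: "F \<subseteq> topspace Omega"
      using F(2) sub by blast
    \<comment> \<open>Minimality of \<open>F\<close>, with a real bound strictly below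
      \<open>d\<close> even if \<open>d\<close> is infinite, so that the estimates below take place
      in the reals.\<close>
    have better: "\<exists>g\<in>W0. \<exists>r. 0 \<le> r \<and> ennreal r < d \<and> (\<forall>x\<in>F'. q g x \<le> r)"
      if F': "closedin Omega F'" "F' \<subset> F" for F'
    proof -
      obtain g where g: "g \<in> W0" "(SUP x\<in>F'. ennreal (q g x)) < d"
        using min F' by blast
      then obtain r where r: "(SUP x\<in>F'. ennreal (q g x)) < r" "r < d"
        using dense by blast
      have re: "ennreal (enn2real r) = r"
        using r(2) by (metis ennreal_enn2real order_less_le_trans top_greatest)
      have "q g x \<le> enn2real r" if "x \<in> F'" for x
      proof -
        have "ennreal (q g x) \<le> ennreal (enn2real r)"
          unfolding re using that r(1) by (meson SUP_upper less_imp_le order_trans)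
        then show ?thesis
          by simp
      qed
      then show ?thesis
        using g r re by (intro bexI[of _ g] exI[of _ "enn2real r"]) auto
    qed
    have "h constant_on F" if h: "h \<in> A" and hF: "h ` F \<subseteq> complex_of_real ` {0..1}" for h
    proof (rule ccontr)
      assume nc: "\<not> h constant_on F"
      \<comment> \<open>\<open>k\<close> is continuous on the whole space and agrees with
        \<open>h\<close> on \<open>F\<close>, so its level sets cut closed pieces out of
        \<open>F\<close>.\<close>
      define k where "k x = Re (h x)" for x
      have hk: "h x = complex_of_real (k x)" "0 \<le> k x" "k x \<le> 1" if "x \<in> F" for x
        using hF that unfolding k_def by force+
      have "\<exists>x\<in>F. \<exists>y\<in>F. k x < k y"
      proof (rule ccontr)
        assume "\<not> (\<exists>x\<in>F. \<exists>y\<in>F. k x < k y)"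
        then have "k x = k y" if "x \<in> F" "y \<in> F" for x y
          using that by (meson linorder_neqE_linordered_idom)
        then have "h constant_on F"
          unfolding constant_on_def using hk(1) by (metis)
        then show False
          using nc by blast
      qed
      then obtain y z where yz: "y \<in> F" "z \<in> F" "k y < k z"
        by blast
      \<comment> \<open>\<open>a\<close> and \<open>b\<close> trisect the interval from
        \<open>k y\<close> to \<open>k z\<close>, which lies in \<open>[0,1]\<close>; this makes
        \<open>0 < a\<close> and \<open>b < 1\<close> strict.\<close>
      define a where "a = (2 * k y + k z) / 3"
      define b where "b = (k y + 2 * k z) / 3"
      have ab: "0 < a" "a < b" "b < 1" "k y < a" "b < k z"
        using yz hk[of y] hk[of z] by (auto simp: a_def b_def)
      have "continuous_map Omega euclidean h"
        using assms(5) h unfolding cont_maps_def by auto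
      moreover have "continuous_map euclidean euclidean Re"
        by (simp add: continuous_on_Re)
      ultimately have "continuous_map Omega euclidean (Re \<circ> h)"
        by (rule continuous_map_compose)
      then have ck: "continuous_map Omega euclidean k"
        by (simp add: k_def[abs_def] o_def)
      \<comment> \<open>Cutting at \<open>b\<close> removes \<open>z\<close> and cutting at
        \<open>a\<close> removes \<open>y\<close>. The resulting approximants \<open>gY\<close> and
        \<open>gZ\<close> are both good on the overlap \<open>a \<le> k x \<le> b\<close>.\<close>
      have "closedin Omega (F \<inter> {x \<in> topspace Omega. k x \<in> {..b}})"
        using F ck by (intro closedin_Int closedin_continuous_map_preimage) auto
      moreover have "z \<notin> F \<inter> {x \<in> topspace Omega. k x \<in> {..b}}"
        using ab by simp
      with yz have "F \<inter> {x \<in> topspace Omega. k x \<in> {..b}} \<subset> F"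
        by blast
      ultimately obtain gY rY where Y: "gY \<in> W0" "0 \<le> rY" "ennreal rY < d"
        and rY: "\<forall>x\<in>F \<inter> {x \<in> topspace Omega. k x \<in> {..b}}. q gY x \<le> rY"
        using better by blast
      have qY: "q gY x \<le> rY" if "x \<in> F" "k x \<le> b" for x
        using rY FO that by auto
      have "closedin Omega (F \<inter> {x \<in> topspace Omega. k x \<in> {a..}})"
        using F ck by (intro closedin_Int closedin_continuous_map_preimage) auto
      moreover have "y \<notin> F \<inter> {x \<in> topspace Omega. k x \<in> {a..}}"
        using ab by simp
      with yz have "F \<inter> {x \<in> topspace Omega. k x \<in> {a..}} \<subset> F"
        by blast
      ultimately obtain gZ rZ where Z: "gZ \<in> W0" "0 \<le> rZ" "ennreal rZ < d"
        and rZ: "\<forall>x\<in>F \<inter> {x \<in> topspace Omega. k x \<in> {a..}}. q gZ x \<le> rZ"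
        using better by blast
      have qZ: "q gZ x \<le> rZ" if "x \<in> F" "a \<le> k x" for x
        using rZ FO that by auto
      \<comment> \<open>Outside its own piece an approximant need not be good; a global bound on its
        error suffices there, since the blend gives it a small coefficient.\<close>
      have "\<exists>M\<ge>0. \<forall>x\<in>topspace Omega. q g x \<le> M" if g: "g \<in> W0" for g
      proof -
        obtain M where "0 \<le> M" "\<And>x. x \<in> topspace Omega \<Longrightarrow> v x * p ((f - g) x) \<le> M"
          using CV0_bounded[OF assms(1-3,6) diff[OF g] v p] by blast
        then show ?thesis
          unfolding q_def by auto
      qed
      then obtain MY MZ where M: "0 \<le> MY" "\<forall>x\<in>topspace Omega. q gY x \<le> MY"
        "0 \<le> MZ" "\<forall>x\<in>topspace Omega. q gZ x \<le> MZ"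
        using Y(1) Z(1) by blast
      define r where "r = max rY rZ"
      have r: "0 \<le> r" "ennreal r < d"
        using Y Z by (auto simp: r_def max_def)
      obtain s where s: "ennreal r < s" "s < d"
        using r dense by blast
      have se: "s = ennreal (enn2real s)"
        using s(2) by (metis ennreal_enn2real order_less_le_trans top_greatest)
      then have rs: "r < enn2real s"
        using s r by (metis ennreal_less_iff)
      \<comment> \<open>The gluing error \<open>e * (MY + MZ + 1)\<close> exactly fills the gap
        between \<open>r\<close> and \<open>s\<close>; the summand 1 keeps the denominator
        positive.\<close>
      define e where "e = (enn2real s - r) / (MY + MZ + 1)"
      have e: "0 < e" "e * (MY + MZ + 1) = enn2real s - r"
        using rs M by (auto simp: e_def)
      obtain n N where nN: "\<And>t. 0 \<le> t \<Longrightarrow> t \<le> a \<Longrightarrow> 1 - (1 - t ^ n) ^ N \<le> e"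
        "\<And>t. b \<le> t \<Longrightarrow> t \<le> 1 \<Longrightarrow> (1 - t ^ n) ^ N \<le> e"
        using approximate_step_polynomial[OF ab(1-3) e(1)] by metis
      define \<psi> where "\<psi> x = (1 - h x ^ n) ^ N" for x
      have "blends scl W0 h"
        using assms(9) h unfolding blends_def multiplier_def by blast
      then have "blends scl W0 \<psi>"
        unfolding \<psi>_def by (intro blends_power blends_complement assms(1))
      then have G: "(\<lambda>x. scl (\<psi> x) (gY x) + scl (1 - \<psi> x) (gZ x)) \<in> W0" (is "?G \<in> W0")
        using Y(1) Z(1) unfolding blends_def by blast
      have "q ?G x \<le> enn2real s" if x: "x \<in> F" for x
      proof -
        define w where "w = (1 - k x ^ n) ^ N"
        have w: "0 \<le> w" "w \<le> 1"
          using hk[OF x] by (auto simp: w_def power_le_one)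
        have \<psi>w: "\<psi> x = complex_of_real w"
          by (simp add: \<psi>_def w_def hk(1)[OF x])
        have nrm: "cmod (\<psi> x) = w" "cmod (1 - \<psi> x) = 1 - w"
        proof -
          have "1 - \<psi> x = complex_of_real (1 - w)"
            by (simp add: \<psi>w)
          then show "cmod (\<psi> x) = w" "cmod (1 - \<psi> x) = 1 - w"
            using w by (simp_all only: \<psi>w norm_of_real)
        qed
        \<comment> \<open>As the coefficients sum to 1, \<open>f\<close> splits in the same way, and
          the error of the blend is at most the convex combination of the two errors.\<close>
        have "f x - ?G x = scl (\<psi> x) (f x - gY x) + scl (1 - \<psi> x) (f x - gZ x)"
          by (simp add: scale_right_diff_distrib scale_left_diff_distrib)
        then have "p (f x - ?G x) \<le> w * p (f x - gY x) + (1 - w) * p (f x - gZ x)"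
          using sp(2,3) nrm by metis
        then have "q ?G x \<le> v x * (w * p (f x - gY x) + (1 - w) * p (f x - gZ x))"
          unfolding q_def using v0 x FO by (intro mult_left_mono) auto
        then have qG: "q ?G x \<le> w * q gY x + (1 - w) * q gZ x"
          by (simp add: q_def algebra_simps)
        have err: "e * MY \<le> e * (MY + MZ + 1)" "e * MZ \<le> e * (MY + MZ + 1)"
          using e(1) M by (intro mult_left_mono; simp)+
        have q0: "0 \<le> q g x" for g
          unfolding q_def using v0 x FO sp(1) by (intro mult_nonneg_nonneg) auto
        \<comment> \<open>Below \<open>a\<close> the coefficient \<open>1 - w\<close> of the
          uncontrolled \<open>gZ\<close> is at most \<open>e\<close>; above \<open>b\<close> the
          coefficient \<open>w\<close> of \<open>gY\<close> is. In between both errors are at most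
          \<open>r\<close>, so the value of \<open>w\<close> is irrelevant.\<close>
        consider "k x < a" | "a \<le> k x" "k x \<le> b" | "b < k x"
          by linarith
        then have "w * q gY x + (1 - w) * q gZ x \<le> r + e * (MY + MZ + 1)"
        proof cases
          case 1
          have "w * q gY x \<le> 1 * r"
            using 1 ab w q0 qY[OF x] r by (intro mult_mono) (auto simp: r_def)
          moreover have "(1 - w) * q gZ x \<le> e * MZ"
            using 1 nN(1)[of "k x"] hk[OF x] q0 bspec[OF M(4) subsetD[OF FO x]] e w
            by (intro mult_mono) (auto simp: w_def)
          ultimately show ?thesis
            using err by linarith
        next
          case 2
          have "w * q gY x + (1 - w) * q gZ x \<le> w * r + (1 - w) * r"
            using 2 x w qY[OF x] qZ[OF x] by (intro add_mono mult_left_mono) (auto simp: r_def)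
          also have "\<dots> = r"
            by (simp add: algebra_simps)
          finally show ?thesis
            using rs e by linarith
        next
          case 3
          have "(1 - w) * q gZ x \<le> 1 * r"
            using 3 ab w q0 qZ[OF x] r by (intro mult_mono) (auto simp: r_def)
          moreover have "w * q gY x \<le> e * MY"
            using 3 nN(2)[of "k x"] hk[OF x] q0 bspec[OF M(2) subsetD[OF FO x]] e w
            by (intro mult_mono) (auto simp: w_def)
          ultimately show ?thesis
            using err by linarith
        qed
        then show ?thesis
          using qG e by linarith
      qed
      \<comment> \<open>The blend belongs to \<open>W0\<close> and has error at most
        \<open>s < d\<close> on \<open>F\<close>, against the choice of \<open>F\<close>.\<close>
      then have "(SUP x\<in>F. ennreal (q ?G x)) \<le> s"
        by (subst se, intro SUP_least ennreal_leI)
      then show False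
        using bspec[OF dF imageI[OF G]] s by (meson leD le_less_trans)
    qed
    then have "antisymmetric Omega A v F"
      using F unfolding antisymmetric_def by blast
    moreover have "wdist v p F f W0 = d"
    proof (rule antisym)
      show "d \<le> wdist v p F f W0"
        unfolding wd using dF by (intro INF_greatest) blast
    qed (fact wd_mono[OF FO])
    ultimately show ?thesis
      unfolding d_def by blast
  qed
qed

end
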